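(* Let $n\ge2$ and let $$L_{\mathrm{star}}=\frac{n}{n-1}\begin{bmatrix}I_{n-1} & -\mathbf 1\\ \mathbf 0^\intercal & 0\end{bmatrix},\qquad L_{\mathrm{comp}}=\frac{n}{n-1}\Bigl(I-\frac1n\mathbf 1\mathbf 1^\intercal\Bigr)$$ be the weighted Laplacians of the imploding star graph (all-to-one network, edge weights $\frac n{n-1}$) and of the complete graph with uniform edge weights $\frac1{n-1}$ (all-to-all network). Take the output matrix $C=I-\frac1n\mathbf 1\mathbf 1^\intercal$ and a random impulse input $\mathbf w(t)=\mathbf w_0\delta(t)$ with $E[\mathbf w_0\mathbf w_0^*]=I$ and zero initial condition, and let $P_{dav}=\int_0^\infty\mathbf y(t)^*\mathbf y(t)\,dt$. Then the all-to-one network ($L=L_{\mathrm{star}}$) and the all-to-all network ($L=L_{\mathrm{comp}}$) have the same value of $E[P_{dav}]$, namely: (i) for the single-integrator network $\dot{\mathbf x}=-L\mathbf x+\mathbf w$, $\mathbf y=C\mathbf x$: $$E[P_{dav}]=\frac{(n-1)^2}{2n};$$ (ii) for the double-integrator network with $\mathbf y=C\mathbf x$: $$E[P_{dav}]=\frac{n-1}{2\bigl(k_p+\gamma_p\frac n{n-1}\bigr)\bigl(k_d+\gamma_d\frac n{n-1}\bigr)};$$ (iii) for the double-integrator network with $\mathbf y=C\mathbf v$: $$E[P_{dav}]=\frac{n-1}{2\bigl(k_d+\gamma_d\frac n{n-1}\bigr)}.$$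
   Context: The double-integrator network with Laplacian $L$ is $$\begin{bmatrix}\dot{\mathbf x}\\ \dot{\mathbf v}\end{bmatrix}=\begin{bmatrix}0 & I\\ -k_p I-\gamma_p L & -k_d I-\gamma_d L\end{bmatrix}\begin{bmatrix}\mathbf x\\ \mathbf v\end{bmatrix}+\begin{bmatrix}0\\ I\end{bmatrix}\mathbf w,$$ with gains $k_p,k_d,\gamma_p,\gamma_d\ge0$, at least one of $(k_p,\gamma_p)$ and at least one of $(k_d,\gamma_d)$ nonzero. $\mathbf 1$ denotes the all-ones vector of the appropriate dimension. $P_{dav}$ measures the aggregate deviation of the state from its average. *)

theory Defs
  imports "HOL-Probability.Probability"
begin

text \<open>
  Signals are vectors over \<open>complex\<close>, so that the adjoint is the conjugate transpose and
  \<open>y\<^sup>* y = (norm y)\<^sup>2\<close>; real-valued signals are the special case of vectors with real entries.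
\<close>

section \<open>Block matrices\<close>

definition block_row :: "'a ^ 'p ^ 'm \<Rightarrow> 'a ^ 'q ^ 'm \<Rightarrow> 'a ^ ('p + 'q) ^ 'm" where
  "block_row X Y = (\<chi> i j. case j of Inl a \<Rightarrow> X $ i $ a | Inr b \<Rightarrow> Y $ i $ b)"

definition block_col :: "'a ^ 'm ^ 'p \<Rightarrow> 'a ^ 'm ^ 'q \<Rightarrow> 'a ^ 'm ^ ('p + 'q)" where
  "block_col X Y = (\<chi> i. case i of Inl a \<Rightarrow> X $ a | Inr b \<Rightarrow> Y $ b)"

section \<open>Impulse responses of linear systems\<close>

text \<open>
  Zero initial condition and input \<open>w \<delta>(t)\<close> in \<open>z' = A z + B w \<delta>(t)\<close>: the state vanishes for
  \<open>t < 0\<close>, and integrating the equation over \<open>(-\<infinity>, t]\<close> for \<open>t \<ge> 0\<close>, where the unit mass at \<open>0\<close>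
  contributes \<open>B w\<close>, gives \<open>z t = \<integral>\<^sub>0\<^sup>t A z(s) ds + B w\<close>. This integral equation has exactly
  one solution, which is picked by \<open>impulse_response\<close>.
\<close>

definition is_impulse_response ::
  "complex ^ 's ^ 's \<Rightarrow> complex ^ 'm ^ 's \<Rightarrow> complex ^ 'm \<Rightarrow> (real \<Rightarrow> complex ^ 's) \<Rightarrow> bool" where
  "is_impulse_response A B w z \<longleftrightarrow>
     (\<forall>t<0. z t = 0) \<and>
     (\<forall>t\<ge>0. ((\<lambda>s. A *v z s) has_integral (z t - B *v w)) {0..t})"

definition impulse_response ::
  "complex ^ 's ^ 's \<Rightarrow> complex ^ 'm ^ 's \<Rightarrow> complex ^ 'm \<Rightarrow> real \<Rightarrow> complex ^ 's" where
  "impulse_response A B w = (THE z. is_impulse_response A B w z)"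

text \<open>\<open>P\<^sub>d\<^sub>a\<^sub>v\<close> for the output \<open>y = C z\<close>, as an element of \<open>[0, \<infinity>]\<close>.\<close>

definition P_dav ::
  "complex ^ 's ^ 's \<Rightarrow> complex ^ 'm ^ 's \<Rightarrow> complex ^ 's ^ 'p \<Rightarrow> complex ^ 'm \<Rightarrow> ennreal" where
  "P_dav A B C w =
     (\<integral>\<^sup>+ t \<in> {0..}. ennreal ((norm (C *v impulse_response A B w t))\<^sup>2) \<partial>lborel)"

definition expected_P_dav ::
  "'w measure \<Rightarrow> ('w \<Rightarrow> complex ^ 'm) \<Rightarrow>
     complex ^ 's ^ 's \<Rightarrow> complex ^ 'm ^ 's \<Rightarrow> complex ^ 's ^ 'p \<Rightarrow> ennreal" where
  "expected_P_dav M w0 A B C = (\<integral>\<^sup>+ \<omega>. P_dav A B C (w0 \<omega>) \<partial>M)"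

definition outer_adj :: "complex ^ 'm \<Rightarrow> complex ^ 'm ^ 'm" where
  "outer_adj w = (\<chi> i j. w $ i * cnj (w $ j))"

section \<open>The networks\<close>

definition dev_avg :: "complex ^ 'n ^ 'n" where
  "dev_avg = mat 1 - (1 / real CARD('n)) *\<^sub>R (\<chi> i j. 1)"

text \<open>
  The index type carries no order, so the node listed last in the block form of the star
  Laplacian is the parameter \<open>r\<close>.
\<close>

definition L_star :: "'n \<Rightarrow> complex ^ 'n ^ 'n" where
  "L_star r = (real CARD('n) / (real CARD('n) - 1)) *\<^sub>R
     (\<chi> i j. if i = r then 0 else if j = r then - 1 else if i = j then 1 else 0)"

definition L_comp :: "complex ^ 'n ^ 'n" where
  "L_comp = (real CARD('n) / (real CARD('n) - 1)) *\<^sub>R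
     (mat 1 - (1 / real CARD('n)) *\<^sub>R (\<chi> i j. 1))"

definition double_A ::
  "real \<Rightarrow> real \<Rightarrow> real \<Rightarrow> real \<Rightarrow> complex ^ 'n ^ 'n \<Rightarrow> complex ^ ('n + 'n) ^ ('n + 'n)" where
  "double_A kp \<gamma>p kd \<gamma>d L =
     block_col (block_row 0 (mat 1))
               (block_row (- (kp *\<^sub>R mat 1) - \<gamma>p *\<^sub>R L) (- (kd *\<^sub>R mat 1) - \<gamma>d *\<^sub>R L))"

definition double_B :: "complex ^ 'n ^ ('n + 'n)" where
  "double_B = block_col 0 (mat 1)"

definition E_single :: "'w measure \<Rightarrow> ('w \<Rightarrow> complex ^ 'n) \<Rightarrow> complex ^ 'n ^ 'n \<Rightarrow> ennreal" where
  "E_single M w0 L = expected_P_dav M w0 (- L) (mat 1) dev_avg"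

definition E_double_pos ::
  "'w measure \<Rightarrow> ('w \<Rightarrow> complex ^ 'n) \<Rightarrow> real \<Rightarrow> real \<Rightarrow> real \<Rightarrow> real \<Rightarrow> complex ^ 'n ^ 'n \<Rightarrow> ennreal"
  where "E_double_pos M w0 kp \<gamma>p kd \<gamma>d L =
     expected_P_dav M w0 (double_A kp \<gamma>p kd \<gamma>d L) double_B (block_row dev_avg (0 :: complex ^ 'n ^ 'n))"

definition E_double_vel ::
  "'w measure \<Rightarrow> ('w \<Rightarrow> complex ^ 'n) \<Rightarrow> real \<Rightarrow> real \<Rightarrow> real \<Rightarrow> real \<Rightarrow> complex ^ 'n ^ 'n \<Rightarrow> ennreal"
  where "E_double_vel M w0 kp \<gamma>p kd \<gamma>d L =
     expected_P_dav M w0 (double_A kp \<gamma>p kd \<gamma>d L) double_B (block_row (0 :: complex ^ 'n ^ 'n) dev_avg)"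

end

theory Submission
  imports Defs
begin

text \<open>
  The deviation operator \<open>C\<close> annihilates the all-ones vector, so \<open>C L = c C\<close> with \<open>c = n / (n - 1)\<close>
  for both Laplacians. Hence the deviations \<open>C x\<close> and \<open>C v\<close> obey a closed equation that does not
  see which network is used: exponential decay at rate \<open>c\<close>, or the damped oscillator
  \<open>p' = q\<close>, \<open>q' = - a p - b q\<close> with \<open>a = k\<^sub>p + \<gamma>\<^sub>p c\<close> and \<open>b = k\<^sub>d + \<gamma>\<^sub>d c\<close>. The energy integrals are read
  off from Lyapunov functions without solving these equations, and are multiples of \<open>\<bar>C w\<^sub>0\<bar>\<^sup>2\<close>,
  whose expectation is \<open>trace (C C\<^sup>*) = n - 1\<close>.
\<close>

section \<open>Linear flows and impulse responses\<close>

text \<open>The flow is the exponential series of \<open>t f\<close> applied to \<open>v\<close>,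
  dominated by the scalar series of \<open>exp (\<bar>t\<bar> * onorm f) * norm v\<close>.\<close>

lemma linear_flow_exists:
  fixes f :: "'a::euclidean_space \<Rightarrow> 'a"
  assumes "linear f"
  shows "\<exists>z. z 0 = v \<and> (\<forall>t. (z has_vector_derivative f (z t)) (at t))"
proof -
  have bl: "bounded_linear f"
    using assms by (simp add: linear_conv_bounded_linear)
  define z where "z t = (\<Sum>k. (t ^ k / fact k) *\<^sub>R (f ^^ k) v)" for t :: real
  have iter_bound: "norm ((f ^^ k) v) \<le> onorm f ^ k * norm v" for k
  proof (induction k)
    case (Suc k)
    have "norm ((f ^^ Suc k) v) \<le> onorm f * norm ((f ^^ k) v)"
      using onorm[OF bl] by simp
    also have "\<dots> \<le> onorm f * (onorm f ^ k * norm v)"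
      using Suc onorm_pos_le[OF bl] by (rule mult_left_mono)
    finally show ?case by (simp add: mult.assoc)
  qed simp
  have summ: "summable (\<lambda>k. (t ^ k / fact k) *\<^sub>R (f ^^ k) v)" for t :: real
  proof (rule summable_comparison_test)
    have "norm ((t ^ k / fact k) *\<^sub>R (f ^^ k) v) \<le> (\<bar>t\<bar> * onorm f) ^ k /\<^sub>R fact k * norm v" for k
      using mult_left_mono[OF iter_bound[of k], of "\<bar>t\<bar> ^ k / fact k"]
      by (simp add: power_abs power_mult_distrib field_simps)
    then show "\<exists>N. \<forall>k\<ge>N. norm ((t ^ k / fact k) *\<^sub>R (f ^^ k) v)
        \<le> (\<bar>t\<bar> * onorm f) ^ k /\<^sub>R fact k * norm v"
      by blast
    show "summable (\<lambda>k. (\<bar>t\<bar> * onorm f) ^ k /\<^sub>R fact k * norm v)"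
      by (intro summable_mult2 summable_exp_generic)
  qed
  have "(z has_vector_derivative f (z t)) (at t)" for t
    unfolding has_vector_derivative_def
  proof (subst has_derivative_componentwise_within, intro ballI)
    \<comment> \<open>Each coordinate is a scalar power series with coefficients \<open>c k\<close>,
      which can be differentiated termwise. The index shift in \<open>diffs\<close> cancels one
      factor of the factorial and leaves one more application of \<open>f\<close>.\<close>
    fix b :: 'a
    define c where "c k = ((f ^^ k) v \<bullet> b) / fact k" for k
    have c_sums: "(\<lambda>k. c k * s ^ k) sums (z s \<bullet> b)" for s
      using bounded_linear.sums[OF bounded_linear_inner_left summable_sums[OF summ], of s b]
      by (simp add: z_def c_def mult.commute)
    have "(\<lambda>k. f ((t ^ k / fact k) *\<^sub>R (f ^^ k) v) \<bullet> b) sums (f (z t) \<bullet> b)"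
      unfolding z_def
      by (intro bounded_linear.sums[OF bounded_linear_inner_left] bounded_linear.sums[OF bl]
          summable_sums summ)
    moreover have "f ((t ^ k / fact k) *\<^sub>R (f ^^ k) v) \<bullet> b = diffs c k * t ^ k" for k
      by (simp add: diffs_def c_def linear_scale[OF assms] divide_simps del: of_nat_Suc)
    ultimately have "(\<Sum>k. diffs c k * t ^ k) = f (z t) \<bullet> b"
      by (simp add: sums_iff)
    moreover have "((\<lambda>s. \<Sum>k. c k * s ^ k) has_field_derivative (\<Sum>k. diffs c k * t ^ k)) (at t)"
      by (rule termdiffs_strong_converges_everywhere) (rule sums_summable[OF c_sums])
    ultimately have "((\<lambda>s. z s \<bullet> b) has_field_derivative f (z t) \<bullet> b) (at t)"
      using sums_unique[OF c_sums] by simp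
    then show "((\<lambda>s. z s \<bullet> b) has_derivative (\<lambda>h. (h *\<^sub>R f (z t)) \<bullet> b)) (at t)"
      by (simp add: has_field_derivative_def mult.commute[of _ "f (z t) \<bullet> b"])
  qed
  moreover have "z 0 = v"
    unfolding z_def by (subst suminf_finite[of "{0}"]) auto
  ultimately show ?thesis by blast
qed

lemma has_real_derivative_inner:
  fixes x y :: "real \<Rightarrow> 'a::real_inner"
  assumes "(x has_vector_derivative x') (at t)" "(y has_vector_derivative y') (at t)"
  shows "((\<lambda>t. x t \<bullet> y t) has_real_derivative x t \<bullet> y' + x' \<bullet> y t) (at t)"
  unfolding has_real_derivative_iff_has_vector_derivative
  by (intro bounded_bilinear.has_vector_derivative[OF bounded_bilinear_inner] assms)

text \<open>Uniqueness for impulse responses, with \<open>d\<close> the difference of two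
  candidates. The equation itself supplies the regularity: \<open>d\<close> is an indefinite
  integral, hence continuous, so the integrand is continuous and \<open>d\<close> is
  differentiable.\<close>

lemma linear_integral_equation_zero:
  fixes f :: "'a::euclidean_space \<Rightarrow> 'a" and d :: "real \<Rightarrow> 'a"
  assumes "linear f"
    and int: "\<And>t. 0 \<le> t \<Longrightarrow> ((\<lambda>s. f (d s)) has_integral d t) {0..t}"
    and "0 \<le> T"
  shows "d T = 0"
proof (cases "T = 0")
  case True
  then show ?thesis
    using has_integral_unique[OF int[of 0] has_integral_null_real[of 0 0 "\<lambda>s. f (d s)"]] by simp
next
  case False
  with \<open>0 \<le> T\<close> have "0 < T" by simp
  have bl: "bounded_linear f"
    using assms by (simp add: linear_conv_bounded_linear)
  have d_eq: "d u = integral {0..u} (\<lambda>s. f (d s))" if "0 \<le> u" for u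
    using integral_unique[OF int[OF that]] by simp
  have "(\<lambda>s. f (d s)) integrable_on {0..T}"
    using int[OF \<open>0 \<le> T\<close>] by blast
  from indefinite_integral_continuous_1[OF this] have cont: "continuous_on {0..T} d"
    by (rule continuous_on_eq) (simp add: d_eq)
  \<comment> \<open>The equation gives a two-sided derivative only at interior points, so the
    monotonicity argument below combines these with continuity on the closed interval.\<close>
  have deriv: "(d has_vector_derivative f (d t)) (at t)" if "0 < t" "t < T" for t
  proof -
    have "((\<lambda>u. integral {0..u} (\<lambda>s. f (d s))) has_vector_derivative f (d t)) (at t within {0..T})"
      using that by (intro integral_has_vector_derivative
          bounded_linear.continuous_on[OF bl cont]) auto
    then have "(d has_vector_derivative f (d t)) (at t within {0..T})"
      by (rule has_vector_derivative_transform[rotated 2]) (use that d_eq in auto)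
    then show ?thesis
      using that by (simp add: at_within_Icc_at)
  qed
  define K where "K = onorm f"
  \<comment> \<open>Gronwall: the weight \<open>exp (- 2 K t)\<close> makes \<open>\<bar>d t\<bar>\<^sup>2\<close> nonincreasing.\<close>
  define h where "h t = exp (- (2 * K) * t) * (d t \<bullet> d t)" for t
  have "h T \<le> h 0"
  proof (rule DERIV_nonpos_imp_decreasing_open[where f = h])
    show "0 \<le> T" by fact
    show "continuous_on {0..T} h"
      unfolding h_def by (intro continuous_intros cont)
    fix t assume t: "0 < t" "t < T"
    have "((\<lambda>t. d t \<bullet> d t) has_real_derivative d t \<bullet> f (d t) + f (d t) \<bullet> d t) (at t)"
      by (intro has_real_derivative_inner deriv t)
    then have "(h has_real_derivative
        exp (- (2 * K) * t) * (2 * (d t \<bullet> f (d t)) - 2 * K * (d t \<bullet> d t))) (at t)"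
      unfolding h_def by (auto intro!: derivative_eq_intros simp: inner_commute algebra_simps)
    moreover have "d t \<bullet> f (d t) \<le> K * (d t \<bullet> d t)"
    proof -
      have "d t \<bullet> f (d t) \<le> norm (d t) * norm (f (d t))"
        by (rule norm_cauchy_schwarz)
      also have "\<dots> \<le> norm (d t) * (K * norm (d t))"
        unfolding K_def by (intro mult_left_mono onorm bl) simp
      finally show ?thesis
        by (simp add: dot_square_norm power2_eq_square mult_ac)
    qed
    ultimately show "\<exists>y. (h has_real_derivative y) (at t) \<and> y \<le> 0"
      by (intro exI[of _ "exp (- (2 * K) * t) * (2 * (d t \<bullet> f (d t)) - 2 * K * (d t \<bullet> d t))"])
        (simp add: mult_nonneg_nonpos)
  qed
  moreover have "d 0 = 0"
    using d_eq[of 0] by simp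
  ultimately have "exp (- (2 * K) * T) * (d T \<bullet> d T) \<le> 0"
    by (simp add: h_def)
  then have "d T \<bullet> d T \<le> 0"
    by (simp add: mult_le_0_iff not_le[symmetric])
  then show ?thesis
    by (metis inner_gt_zero_iff not_le)
qed

lemma matrix_flow_exists:
  fixes A :: "complex ^ 's ^ 's"
  shows "\<exists>z. z 0 = v \<and> (\<forall>t. (z has_vector_derivative A *v z t) (at t))"
  by (rule linear_flow_exists) simp

text \<open>Replaces the definite description by an initial value problem: the impulse acts as the
  initial state \<open>B *v w\<close>.\<close>

lemma impulse_response_flow:
  assumes init: "z 0 = B *v w"
    and flow: "\<And>t. (z has_vector_derivative A *v z t) (at t)"
    and "0 \<le> t"
  shows "impulse_response A B w t = z t"
proof -
  \<comment> \<open>\<open>z\<close> is differentiable on the whole line, whereas the impulse response jumps at \<open>0\<close>.\<close>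
  define z\<^sub>0 where "z\<^sub>0 t = (if t < 0 then 0 else z t)" for t
  have z\<^sub>0: "is_impulse_response A B w z\<^sub>0"
    unfolding is_impulse_response_def
  proof (intro conjI allI impI)
    fix t :: real assume "0 \<le> t"
    then have "((\<lambda>s. A *v z s) has_integral z t - z 0) {0..t}"
      by (intro fundamental_theorem_of_calculus has_vector_derivative_at_within[OF flow]) auto
    then have "((\<lambda>s. A *v z\<^sub>0 s) has_integral z t - z 0) {0..t}"
      by (rule has_integral_eq[rotated]) (simp add: z\<^sub>0_def)
    then show "((\<lambda>s. A *v z\<^sub>0 s) has_integral z\<^sub>0 t - B *v w) {0..t}"
      using \<open>0 \<le> t\<close> by (simp add: z\<^sub>0_def init)
  qed (simp add: z\<^sub>0_def)
  have "y = z\<^sub>0" if y: "is_impulse_response A B w y" for y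
  proof
    fix t
    show "y t = z\<^sub>0 t"
    proof (cases "t < 0")
      case True
      then show ?thesis using y z\<^sub>0 by (simp add: is_impulse_response_def)
    next
      case False
      \<comment> \<open>The inhomogeneous terms \<open>B *v w\<close> cancel in the difference,
        which therefore solves the homogeneous integral equation.\<close>
      have "y t - z\<^sub>0 t = 0"
      proof (rule linear_integral_equation_zero[where f = "(*v) A" and d = "\<lambda>t. y t - z\<^sub>0 t"])
        fix u :: real assume "0 \<le> u"
        then have "((\<lambda>s. A *v y s - A *v z\<^sub>0 s) has_integral (y u - B *v w) - (z\<^sub>0 u - B *v w)) {0..u}"
          using y z\<^sub>0 unfolding is_impulse_response_def by (intro has_integral_diff) auto
        then show "((\<lambda>s. A *v (y s - z\<^sub>0 s)) has_integral (y u - z\<^sub>0 u)) {0..u}"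
          by (simp add: matrix_vector_mult_diff_distrib)
      qed (use False in auto)
      then show ?thesis by simp
    qed
  qed
  with z\<^sub>0 have "impulse_response A B w = z\<^sub>0"
    unfolding impulse_response_def by (rule the_equality)
  with \<open>0 \<le> t\<close> show ?thesis by (simp add: z\<^sub>0_def)
qed

section \<open>Energy integrals\<close>

text \<open>Gronwall in differential form: the weight \<open>exp (\<delta> * t)\<close> makes
  \<open>S\<close> nonincreasing, so \<open>S\<close> is squeezed between 0 and
  \<open>S 0 * exp (- \<delta> * t)\<close>.\<close>

lemma exponential_decay:
  fixes S :: "real \<Rightarrow> real"
  assumes "0 < \<delta>"
    and deriv: "\<And>t. (S has_real_derivative S' t) (at t)"
    and le: "\<And>t. S' t \<le> - \<delta> * S t"
    and nonneg: "\<And>t. 0 \<le> S t"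
  shows "(S \<longlongrightarrow> 0) at_top"
proof (rule tendsto_sandwich[of "\<lambda>_. 0"])
  have bound: "exp (\<delta> * t) * S t \<le> exp (\<delta> * 0) * S 0" if "0 \<le> t" for t
  proof (rule DERIV_nonpos_imp_nonincreasing[OF that])
    fix u
    have "((\<lambda>t. exp (\<delta> * t) * S t) has_real_derivative exp (\<delta> * u) * (\<delta> * S u + S' u)) (at u)"
      by (auto intro!: derivative_eq_intros deriv simp: algebra_simps)
    moreover have "exp (\<delta> * u) * (\<delta> * S u + S' u) \<le> 0"
      using le[of u] by (intro mult_nonneg_nonpos) auto
    ultimately show "\<exists>y. ((\<lambda>t. exp (\<delta> * t) * S t) has_real_derivative y) (at u) \<and> y \<le> 0"
      by blast
  qed
  have "S t \<le> S 0 * exp (- \<delta> * t)" if "0 \<le> t" for t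
    using bound[OF that] by (simp add: exp_minus field_simps)
  then show "\<forall>\<^sub>F t in at_top. S t \<le> S 0 * exp (- \<delta> * t)"
    by (rule eventually_mono[OF eventually_ge_at_top])
  have "((\<lambda>t. exp (- \<delta> * t)) \<longlongrightarrow> 0) at_top"
    using \<open>0 < \<delta>\<close> by real_asymp
  then show "((\<lambda>t. S 0 * exp (- \<delta> * t)) \<longlongrightarrow> 0) at_top"
    by (rule tendsto_mult_right_zero)
qed (auto simp: nonneg)

text \<open>\<open>- V t / c\<close> is an antiderivative of the energy density that vanishes at
  infinity, so only its value at 0 remains.\<close>

lemma nn_integral_lyapunov:
  fixes x :: "real \<Rightarrow> 'a::{real_normed_vector, second_countable_topology}" and V :: "real \<Rightarrow> real"
  assumes "0 < c"
    and "continuous_on UNIV x"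
    and deriv: "\<And>t. (V has_real_derivative - c * (norm (x t))\<^sup>2) (at t)"
    and lim: "(V \<longlongrightarrow> 0) at_top"
  shows "(\<integral>\<^sup>+ t \<in> {0..}. ennreal ((norm (x t))\<^sup>2) \<partial>lborel) = ennreal (V 0 / c)"
proof -
  have "(\<integral>\<^sup>+ t \<in> {0..}. ennreal ((norm (x t))\<^sup>2) \<partial>lborel) = ennreal (0 - (- V 0 / c))"
  proof (rule nn_integral_FTC_atLeast)
    show "(\<lambda>t. (norm (x t))\<^sup>2) \<in> borel_measurable borel"
      by (intro borel_measurable_continuous_onI continuous_intros assms)
    show "((\<lambda>t. - V t / c) has_real_derivative (norm (x t))\<^sup>2) (at t)" for t
      using \<open>0 < c\<close> by (auto intro!: derivative_eq_intros deriv)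
    show "((\<lambda>t. - V t / c) \<longlongrightarrow> 0) at_top"
      using \<open>0 < c\<close> by (auto intro!: tendsto_eq_intros lim)
  qed simp
  then show ?thesis by simp
qed

lemma continuous_on_flow:
  "(\<And>t. (x has_vector_derivative x' t) (at t)) \<Longrightarrow> continuous_on UNIV x"
  by (intro continuous_at_imp_continuous_on ballI has_vector_derivative_continuous)

text \<open>The squared norm serves as its own Lyapunov function, decaying at rate
  \<open>2 * c\<close>.\<close>

lemma nn_integral_decay:
  fixes y :: "real \<Rightarrow> 'a::euclidean_space"
  assumes "0 < c" and y: "\<And>t. (y has_vector_derivative - c *\<^sub>R y t) (at t)"
  shows "(\<integral>\<^sup>+ t \<in> {0..}. ennreal ((norm (y t))\<^sup>2) \<partial>lborel) = ennreal ((norm (y 0))\<^sup>2 / (2 * c))"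
proof -
  have deriv: "((\<lambda>t. (norm (y t))\<^sup>2) has_real_derivative - (2 * c) * (norm (y t))\<^sup>2) (at t)" for t
    using has_real_derivative_inner[OF y y, of t] by (simp add: power2_norm_eq_inner mult.assoc)
  have "((\<lambda>t. (norm (y t))\<^sup>2) \<longlongrightarrow> 0) at_top"
    using \<open>0 < c\<close> by (intro exponential_decay[OF _ deriv, of "2 * c"]) auto
  then show ?thesis
    using \<open>0 < c\<close> by (intro nn_integral_lyapunov continuous_on_flow[OF y] deriv) auto
qed

lemma
  fixes p q :: "real \<Rightarrow> 'a::euclidean_space"
  assumes "0 < a" "0 < b" "p 0 = 0"
    and p: "\<And>t. (p has_vector_derivative q t) (at t)"
    and q: "\<And>t. (q has_vector_derivative - a *\<^sub>R p t - b *\<^sub>R q t) (at t)"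
  shows nn_integral_oscillator_position: "(\<integral>\<^sup>+ t \<in> {0..}. ennreal ((norm (p t))\<^sup>2) \<partial>lborel) =
      ennreal ((norm (q 0))\<^sup>2 / (2 * a * b))" (is ?position)
    and nn_integral_oscillator_velocity: "(\<integral>\<^sup>+ t \<in> {0..}. ennreal ((norm (q t))\<^sup>2) \<partial>lborel) =
      ennreal ((norm (q 0))\<^sup>2 / (2 * b))" (is ?velocity)
proof -
  \<comment> \<open>\<open>V' = - 2 b \<bar>q\<bar>\<^sup>2\<close> and \<open>W' = - 2 a b \<bar>p\<bar>\<^sup>2\<close>. Neither decay rate is bounded below by a multiple of the
    function itself, but that of the sum \<open>V + W\<close> is: \<open>(V + W)' = - 2 b V\<close>.\<close>
  define V where "V t = a * (p t \<bullet> p t) + q t \<bullet> q t" for t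
  define W where "W t = (b\<^sup>2 + a) * (p t \<bullet> p t) + 2 * b * (p t \<bullet> q t) + q t \<bullet> q t" for t
  note pp = has_real_derivative_inner[OF p p]
  note pq = has_real_derivative_inner[OF p q]
  note qq = has_real_derivative_inner[OF q q]
  have norm_mult_self: "norm x * norm x = x \<bullet> x" for x :: 'a
    by (simp flip: power2_eq_square power2_norm_eq_inner)
  note simps = norm_mult_self inner_diff_left inner_diff_right inner_commute algebra_simps
    power2_eq_square
  have V': "(V has_real_derivative - (2 * b) * (norm (q t))\<^sup>2) (at t)" for t
    unfolding V_def by (auto intro!: derivative_eq_intros pp qq simp: simps)
  \<comment> \<open>The cross term of \<open>W\<close> cancels the dissipation of
    \<open>q t \<bullet> q t\<close> and contributes \<open>- 2 * a * b\<close> times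
    \<open>p t \<bullet> p t\<close>; the coefficient \<open>b\<^sup>2 + a\<close> removes the
    remaining \<open>p t \<bullet> q t\<close> terms.\<close>
  have W': "(W has_real_derivative - (2 * a * b) * (norm (p t))\<^sup>2) (at t)" for t
    unfolding W_def by (auto intro!: derivative_eq_intros pp pq qq simp: simps)
  have V_nonneg: "0 \<le> V t" for t
    using \<open>0 < a\<close> by (simp add: V_def)
  have W_nonneg: "0 \<le> W t" for t
  proof -
    have "W t = (b *\<^sub>R p t + q t) \<bullet> (b *\<^sub>R p t + q t) + a * (p t \<bullet> p t)"
      by (simp add: W_def inner_add_left inner_add_right simps)
    then show ?thesis using \<open>0 < a\<close> by simp
  qed
  \<comment> \<open>\<open>K\<close> is chosen so that \<open>K * V t - (V t + W t)\<close> is a sum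
    of squares; the term \<open>2 * b\<^sup>2 / a\<close> pays for the \<open>b\<^sup>2\<close> in
    \<open>W\<close> and for completing the square with the cross term.\<close>
  define K where "K = 3 + 2 * b\<^sup>2 / a"
  have "0 < K" using \<open>0 < a\<close> by (simp add: K_def add_pos_nonneg)
  have VW_le: "V t + W t \<le> K * V t" for t
  proof -
    have "K * V t - (V t + W t) = (b *\<^sub>R p t - q t) \<bullet> (b *\<^sub>R p t - q t)
        + a * (p t \<bullet> p t) + 2 * b\<^sup>2 / a * (q t \<bullet> q t)"
      using \<open>0 < a\<close> by (simp add: K_def V_def W_def inner_diff_left inner_diff_right
        inner_commute field_simps power2_eq_square)
    moreover have "0 \<le> \<dots>"
      using \<open>0 < a\<close> by (intro add_nonneg_nonneg) auto
    ultimately show ?thesis by linarith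
  qed
  have VW_lim: "((\<lambda>t. V t + W t) \<longlongrightarrow> 0) at_top"
  proof (rule exponential_decay[of "2 * b / K"])
    show "((\<lambda>t. V t + W t) has_real_derivative - (2 * b) * V t) (at t)" for t
      using DERIV_add[OF V'[of t] W'[of t]] by (simp add: V_def simps)
    show "- (2 * b) * V t \<le> - (2 * b / K) * (V t + W t)" for t
      using mult_left_mono[OF VW_le[of t], of "2 * b / K"] \<open>0 < K\<close> \<open>0 < b\<close> by simp
  qed (use \<open>0 < b\<close> \<open>0 < K\<close> V_nonneg W_nonneg in auto)
  have V_lim: "(V \<longlongrightarrow> 0) at_top"
    by (rule tendsto_sandwich[OF _ _ tendsto_const VW_lim]) (auto simp: V_nonneg W_nonneg)
  have W_lim: "(W \<longlongrightarrow> 0) at_top"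
    by (rule tendsto_sandwich[OF _ _ tendsto_const VW_lim]) (auto simp: V_nonneg W_nonneg)
  \<comment> \<open>Since \<open>p 0 = 0\<close>, both Lyapunov functions start at the squared norm
    of \<open>q 0\<close>; the two energies differ only through the rates \<open>2 * a * b\<close>
    and \<open>2 * b\<close>.\<close>
  show ?position
    using nn_integral_lyapunov[OF _ continuous_on_flow[OF p] W' W_lim] \<open>0 < a\<close> \<open>0 < b\<close> \<open>p 0 = 0\<close>
    by (simp add: W_def power2_norm_eq_inner)
  show ?velocity
    using nn_integral_lyapunov[OF _ continuous_on_flow[OF q] V' V_lim] \<open>0 < b\<close> \<open>p 0 = 0\<close>
    by (simp add: V_def power2_norm_eq_inner)
qed

section \<open>The deviation operator\<close>

lemma uminus_matrix_vector_mult: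
  fixes A :: "complex ^ 'n ^ 'm"
  shows "(- A) *v x = - (A *v x)"
  by (simp add: vec_eq_iff matrix_vector_mult_def sum_negf)

lemma scaleR_matrix_vector_mult:
  fixes A :: "complex ^ 'n ^ 'm"
  shows "(k *\<^sub>R A) *v x = k *\<^sub>R (A *v x)"
  by (simp add: vec_eq_iff matrix_vector_mult_def scaleR_sum_right)

lemma dev_avg_mult:
  fixes x :: "complex ^ 'n"
  shows "(dev_avg *v x) $ i = x $ i - (\<Sum>j\<in>UNIV. x $ j) / of_nat CARD('n)"
proof -
  have "(dev_avg *v x) $ i = (\<Sum>j\<in>UNIV. (if i = j then x $ j else 0) - x $ j / of_nat CARD('n))"
    by (auto simp: dev_avg_def matrix_vector_mult_def mat_def
        scaleR_conv_of_real[where 'a = complex] algebra_simps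
        intro!: sum.cong)
  then show ?thesis
    by (simp add: sum_subtractf sum_divide_distrib)
qed

text \<open>The variance identity: squared deviations sum to the sum of squares minus the squared
  modulus of the total over n. Written through \<open>outer_adj\<close>, it is real-linear in the
  matrix whose expectation is prescribed.\<close>

lemma norm_dev_avg_mult:
  fixes x :: "complex ^ 'n"
  shows "(norm (dev_avg *v x))\<^sup>2 =
    Re (\<Sum>i\<in>UNIV. outer_adj x $ i $ i) - Re (\<Sum>i\<in>UNIV. \<Sum>j\<in>UNIV. outer_adj x $ i $ j) / CARD('n)"
proof -
  let ?n = "real CARD('n)"
  define m where "m = (\<Sum>j\<in>UNIV. x $ j) / of_nat CARD('n)"
  have sum_x: "(\<Sum>j\<in>UNIV. x $ j) = ?n *\<^sub>R m"
    by (simp add: m_def scaleR_conv_of_real)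
  have "(norm (dev_avg *v x))\<^sup>2 = (\<Sum>i\<in>UNIV. (x $ i - m) \<bullet> (x $ i - m))"
    by (simp add: power2_norm_eq_inner inner_vec_def dev_avg_mult m_def)
  also have "\<dots> = (\<Sum>i\<in>UNIV. x $ i \<bullet> x $ i) - 2 * ((\<Sum>i\<in>UNIV. x $ i) \<bullet> m) + ?n * (m \<bullet> m)"
    by (simp add: inner_diff_left inner_diff_right inner_commute sum.distrib sum_subtractf
        inner_sum_left inner_sum_right sum_distrib_left algebra_simps)
  also have "\<dots> = (\<Sum>i\<in>UNIV. x $ i \<bullet> x $ i) - (\<Sum>i\<in>UNIV. x $ i) \<bullet> (\<Sum>i\<in>UNIV. x $ i) / ?n"
    by (simp add: sum_x)
  also have "(\<Sum>i\<in>UNIV. x $ i \<bullet> x $ i) = Re (\<Sum>i\<in>UNIV. outer_adj x $ i $ i)"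
    by (simp add: outer_adj_def inner_complex_def)
  also have "(\<Sum>i\<in>UNIV. x $ i) \<bullet> (\<Sum>i\<in>UNIV. x $ i) = Re (\<Sum>i\<in>UNIV. \<Sum>j\<in>UNIV. outer_adj x $ i $ j)"
    by (simp add: outer_adj_def inner_complex_def sum_product sum.distrib)
  finally show ?thesis .
qed

text \<open>The functional \<open>T\<close> is the real part of the trace of
  \<open>dev_avg ** X\<close>. Being linear on a finite-dimensional space, it commutes with the
  Bochner integral.\<close>

lemma expectation_norm_dev_avg:
  fixes w0 :: "'w \<Rightarrow> complex ^ 'n"
  assumes "has_bochner_integral M (\<lambda>\<omega>. outer_adj (w0 \<omega>)) (mat 1)"
  shows "has_bochner_integral M (\<lambda>\<omega>. (norm (dev_avg *v w0 \<omega>))\<^sup>2) (real CARD('n) - 1)"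
proof -
  define T where "T X = Re (\<Sum>i\<in>UNIV. X $ i $ i) - Re (\<Sum>i\<in>UNIV. \<Sum>j\<in>UNIV. X $ i $ j) / CARD('n)"
    for X :: "complex ^ 'n ^ 'n"
  have "linear T"
    by (rule linearI) (simp_all add: T_def sum.distrib sum_distrib_left add_divide_distrib algebra_simps)
  then have "bounded_linear T"
    by (simp add: linear_conv_bounded_linear)
  then have "has_bochner_integral M (\<lambda>\<omega>. T (outer_adj (w0 \<omega>))) (T (mat 1))"
    using assms by (rule has_bochner_integral_bounded_linear)
  \<comment> \<open>The trace gives n; the entries also sum to n, which after division subtracts
    1.\<close>
  moreover have "T (mat 1) = real CARD('n) - 1"
    by (simp add: T_def mat_def if_distrib cong: if_cong)
  ultimately show ?thesis
    by (simp add: T_def norm_dev_avg_mult)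
qed

text \<open>Up to the factor c, the star Laplacian subtracts the value at node \<open>r\<close> from
  every entry, and \<open>dev_avg\<close> ignores a common shift.\<close>

lemma dev_avg_L_star:
  fixes r :: "'n::finite" and x :: "complex ^ 'n"
  shows "dev_avg *v (L_star r *v x) = (real CARD('n) / (real CARD('n) - 1)) *\<^sub>R (dev_avg *v x)"
proof -
  define c where "c = complex_of_real (real CARD('n) / (real CARD('n) - 1))"
  \<comment> \<open>The zero row \<open>r\<close> fits the same formula because the difference
    vanishes there.\<close>
  have L: "(L_star r *v x) $ i = c * (x $ i - x $ r)" for i
  proof -
    have "(L_star r *v x) $ i = (\<Sum>j\<in>UNIV. if i = r then 0 else
        (if j = i then c * x $ j else 0) - (if j = r then c * x $ j else 0))"
      by (auto simp: L_star_def matrix_vector_mult_def c_def scaleR_conv_of_real[where 'a = complex]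
          intro!: sum.cong)
    then show ?thesis
      by (cases "i = r") (simp_all add: sum_subtractf algebra_simps)
  qed
  show ?thesis
    unfolding vec_eq_iff vector_scaleR_component scaleR_conv_of_real[where 'a = complex] dev_avg_mult L
      c_def[symmetric]
    by (simp add: sum_subtractf field_simps flip: sum_distrib_left)
qed

text \<open>\<open>L_comp\<close> is itself c times \<open>dev_avg\<close>, and
  \<open>dev_avg\<close> is idempotent.\<close>

lemma dev_avg_L_comp:
  fixes x :: "complex ^ 'n"
  shows "dev_avg *v (L_comp *v x) = (real CARD('n) / (real CARD('n) - 1)) *\<^sub>R (dev_avg *v x)"
proof -
  define c where "c = real CARD('n) / (real CARD('n) - 1)"
  have "L_comp *v x = c *\<^sub>R (dev_avg *v x)"
    unfolding L_comp_def c_def dev_avg_def[symmetric]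
    by (rule scaleR_matrix_vector_mult)
  moreover have "dev_avg *v (dev_avg *v x) = dev_avg *v x"
    by (simp add: vec_eq_iff dev_avg_mult sum_subtractf)
  ultimately show ?thesis
    by (simp add: c_def linear_scale[OF matrix_vector_mul_linear])
qed

section \<open>The networks\<close>

text \<open>On states of the double integrator, \<open>Inl_part\<close> is the position block and
  \<open>Inr_part\<close> below is the velocity block.\<close>

definition Inl_part :: "'a ^ ('p::finite + 'q::finite) \<Rightarrow> 'a ^ 'p" where
  "Inl_part z = (\<chi> i. z $ Inl i)"

definition Inr_part :: "'a ^ ('p::finite + 'q::finite) \<Rightarrow> 'a ^ 'q" where
  "Inr_part z = (\<chi> i. z $ Inr i)"

lemma block_row_mult:
  fixes X :: "'a::semiring_1 ^ 'p ^ 'm"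
  shows "block_row X Y *v z = X *v Inl_part z + Y *v Inr_part z"
proof -
  \<comment> \<open>A sum over the disjoint union splits; \<open>'b\<close> is the type inferred for
    the column index of \<open>Y\<close>.\<close>
  have "(\<Sum>j\<in>UNIV. g j) = (\<Sum>j\<in>UNIV. g (Inl j)) + (\<Sum>j\<in>UNIV. g (Inr j))" for g :: "'p + 'b \<Rightarrow> 'a"
    using sum.Plus[of UNIV UNIV g] by (simp add: o_def)
  then show ?thesis
    by (simp add: vec_eq_iff matrix_vector_mult_def block_row_def Inl_part_def Inr_part_def)
qed

lemma Inl_part_block_col: "Inl_part (block_col X Y *v z) = X *v z"
  and Inr_part_block_col: "Inr_part (block_col X Y *v z) = Y *v z"
  by (simp_all add: vec_eq_iff matrix_vector_mult_def block_col_def Inl_part_def Inr_part_def)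

lemma P_dav_flow:
  assumes "z 0 = B *v w"
    and "\<And>t. (z has_vector_derivative A *v z t) (at t)"
  shows "P_dav A B C w = (\<integral>\<^sup>+ t \<in> {0..}. ennreal ((norm (C *v z t))\<^sup>2) \<partial>lborel)"
  unfolding P_dav_def
  by (intro nn_integral_cong) (auto simp: indicator_def impulse_response_flow[of z, OF assms])

lemma has_vector_derivative_matrix_mult:
  fixes C :: "complex ^ 'n ^ 'm"
  assumes "(z has_vector_derivative z') (at t)"
  shows "((\<lambda>t. C *v z t) has_vector_derivative C *v z') (at t)"
  using assms by (rule bounded_linear.has_vector_derivative[OF matrix_vector_mul_bounded_linear])

text \<open>The intertwining hypothesis on \<open>L\<close> makes the output
  \<open>dev_avg *v z t\<close> a pure decay at rate \<open>c\<close> that starts from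
  \<open>dev_avg *v w\<close>.\<close>

lemma P_dav_single:
  fixes L :: "complex ^ 'n ^ 'n"
  assumes "0 < c" and L: "\<And>x. dev_avg *v (L *v x) = c *\<^sub>R (dev_avg *v x)"
  shows "P_dav (- L) (mat 1) dev_avg w = ennreal ((norm (dev_avg *v w))\<^sup>2 / (2 * c))"
proof -
  obtain z where z: "z 0 = mat 1 *v w" "\<And>t. (z has_vector_derivative (- L) *v z t) (at t)"
    using matrix_flow_exists by blast
  have "dev_avg *v ((- L) *v x) = - c *\<^sub>R (dev_avg *v x)" for x
    by (simp add: uminus_matrix_vector_mult L linear_neg[OF matrix_vector_mul_linear])
  then have "((\<lambda>t. dev_avg *v z t) has_vector_derivative - c *\<^sub>R (dev_avg *v z t)) (at t)" for t
    using has_vector_derivative_matrix_mult[OF z(2), of dev_avg] by simp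
  from nn_integral_decay[OF \<open>0 < c\<close> this] show ?thesis
    by (simp add: P_dav_flow[OF z] z(1))
qed

text \<open>The deviations of position and velocity are the two outputs of one and the same flow, so
  the two energies are those of a single oscillator.\<close>

lemma
  fixes L :: "complex ^ 'n ^ 'n"
  assumes a: "0 < kp + \<gamma>p * c" and b: "0 < kd + \<gamma>d * c"
    and L: "\<And>x. dev_avg *v (L *v x) = c *\<^sub>R (dev_avg *v x)"
  shows P_dav_double_position:
      "P_dav (double_A kp \<gamma>p kd \<gamma>d L) double_B (block_row dev_avg (0 :: complex ^ 'n ^ 'n)) w =
        ennreal ((norm (dev_avg *v w))\<^sup>2 / (2 * (kp + \<gamma>p * c) * (kd + \<gamma>d * c)))" (is ?position)
    and P_dav_double_velocity:
      "P_dav (double_A kp \<gamma>p kd \<gamma>d L) double_B (block_row (0 :: complex ^ 'n ^ 'n) dev_avg) w =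
        ennreal ((norm (dev_avg *v w))\<^sup>2 / (2 * (kd + \<gamma>d * c)))" (is ?velocity)
proof -
  let ?A = "double_A kp \<gamma>p kd \<gamma>d L"
  obtain z where z: "z 0 = double_B *v w" "\<And>t. (z has_vector_derivative ?A *v z t) (at t)"
    using matrix_flow_exists by blast
  let ?pos = "block_row dev_avg (0 :: complex ^ 'n ^ 'n)"
  let ?vel = "block_row (0 :: complex ^ 'n ^ 'n) dev_avg"
  \<comment> \<open>Both feedback blocks have this shape: \<open>k\<close>, \<open>\<gamma>\<close>
    stand for the position gains and for the velocity gains.\<close>
  have feedback: "dev_avg *v ((- (k *\<^sub>R mat 1) - \<gamma> *\<^sub>R L) *v x) = - (k + \<gamma> * c) *\<^sub>R (dev_avg *v x)"
    for k \<gamma> x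
  proof -
    have mult: "(- (k *\<^sub>R mat 1) - \<gamma> *\<^sub>R L) *v x = - (k *\<^sub>R x) - \<gamma> *\<^sub>R (L *v x)"
      by (simp add: matrix_vector_mult_diff_rdistrib uminus_matrix_vector_mult
          scaleR_matrix_vector_mult)
    show ?thesis
      unfolding mult
      by (simp add: linear_diff[OF matrix_vector_mul_linear] linear_neg[OF matrix_vector_mul_linear]
          linear_scale[OF matrix_vector_mul_linear] L algebra_simps)
  qed
  have pos: "?pos *v (?A *v x) = ?vel *v x" for x
    by (simp add: double_A_def block_row_mult Inl_part_block_col)
  have vel: "?vel *v (?A *v x) = - (kp + \<gamma>p * c) *\<^sub>R (?pos *v x) - (kd + \<gamma>d * c) *\<^sub>R (?vel *v x)" for x
    by (simp add: double_A_def block_row_mult Inr_part_block_col matrix_vector_right_distrib feedback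
        scaleR_left_distrib scaleR_left_diff_distrib)
  have p: "((\<lambda>t. ?pos *v z t) has_vector_derivative ?vel *v z t) (at t)" for t
    using has_vector_derivative_matrix_mult[OF z(2), of ?pos] by (simp add: pos)
  have q: "((\<lambda>t. ?vel *v z t) has_vector_derivative
      - (kp + \<gamma>p * c) *\<^sub>R (?pos *v z t) - (kd + \<gamma>d * c) *\<^sub>R (?vel *v z t)) (at t)" for t
    using has_vector_derivative_matrix_mult[OF z(2), of ?vel] by (simp add: vel)
  \<comment> \<open>The impulse enters through the velocity block only, so the oscillator starts at
    rest position with velocity \<open>dev_avg *v w\<close>.\<close>
  have p0: "?pos *v z 0 = 0"
    by (simp add: z(1) double_B_def block_row_mult Inl_part_block_col)
  have q0: "?vel *v z 0 = dev_avg *v w"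
    by (simp add: z(1) double_B_def block_row_mult Inr_part_block_col)
  show ?position
    using nn_integral_oscillator_position[OF a b p0 p q] by (simp add: P_dav_flow[OF z] q0)
  show ?velocity
    using nn_integral_oscillator_velocity[OF a b p0 p q] by (simp add: P_dav_flow[OF z] q0)
qed

text \<open>Once the energy of every fixed impulse is the same multiple of
  \<open>(norm (dev_avg *v w))\<^sup>2\<close>, its expectation depends only on the second moments
  of \<open>w0\<close>.\<close>

lemma expected_P_dav_eq:
  fixes w0 :: "'w \<Rightarrow> complex ^ 'n"
  assumes cov: "has_bochner_integral M (\<lambda>\<omega>. outer_adj (w0 \<omega>)) (mat 1)"
    and P: "\<And>w. P_dav A B C w = ennreal ((norm (dev_avg *v w))\<^sup>2 / k)" and "0 < k"
  shows "expected_P_dav M w0 A B C = ennreal ((real CARD('n) - 1) / k)"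
proof -
  have "has_bochner_integral M (\<lambda>\<omega>. (norm (dev_avg *v w0 \<omega>))\<^sup>2 / k) ((real CARD('n) - 1) / k)"
    using expectation_norm_dev_avg[OF cov] by (rule has_bochner_integral_divide_zero)
  then show ?thesis
    unfolding expected_P_dav_def P has_bochner_integral_iff
    using \<open>0 < k\<close> by (subst nn_integral_eq_integral) auto
qed

theorem mainTheorem8:
  fixes M :: "'w measure" and w0 :: "'w \<Rightarrow> complex ^ 'n"
    and r :: 'n and n :: nat and kp kd \<gamma>p \<gamma>d :: real
  assumes n: "n = CARD('n)" "n \<ge> 2"
    and prob: "prob_space M"
    and rv: "w0 \<in> borel_measurable M"
    and cov: "has_bochner_integral M (\<lambda>\<omega>. outer_adj (w0 \<omega>)) (mat 1)"
    and gains: "kp \<ge> 0" "kd \<ge> 0" "\<gamma>p \<ge> 0" "\<gamma>d \<ge> 0"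
      "kp \<noteq> 0 \<or> \<gamma>p \<noteq> 0" "kd \<noteq> 0 \<or> \<gamma>d \<noteq> 0"
  shows
    "\<forall>L \<in> {L_star r, L_comp}.
       E_single M w0 L = ennreal ((real n - 1)\<^sup>2 / (2 * real n)) \<and>
       E_double_pos M w0 kp \<gamma>p kd \<gamma>d L =
         ennreal ((real n - 1) /
           (2 * (kp + \<gamma>p * (real n / (real n - 1))) * (kd + \<gamma>d * (real n / (real n - 1))))) \<and>
       E_double_vel M w0 kp \<gamma>p kd \<gamma>d L =
         ennreal ((real n - 1) / (2 * (kd + \<gamma>d * (real n / (real n - 1)))))"
proof
  fix L :: "complex ^ 'n ^ 'n" assume "L \<in> {L_star r, L_comp}"
  define c where "c = real n / (real n - 1)"
  have c: "0 < c" using n(2) by (simp add: c_def)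
  \<comment> \<open>From here on both networks are treated alike: they enter only through this
    identity, with the same \<open>c\<close>.\<close>
  have L: "dev_avg *v (L *v x) = c *\<^sub>R (dev_avg *v x)" for x
    using \<open>L \<in> _\<close> dev_avg_L_star[of r x] dev_avg_L_comp[of x] by (auto simp: c_def n(1))
  \<comment> \<open>Both summands are nonnegative and at least one gain of each pair is positive, so
    the stiffness and likewise the damping below are positive.\<close>
  have a: "0 < kp + \<gamma>p * c"
    using gains c by (cases "kp = 0") (auto intro: add_pos_nonneg)
  have b: "0 < kd + \<gamma>d * c"
    using gains c by (cases "kd = 0") (auto intro: add_pos_nonneg)
  have "E_single M w0 L = ennreal ((real n - 1) / (2 * c))"
    unfolding E_single_def n(1)
    using c by (intro expected_P_dav_eq[OF cov] P_dav_single L) auto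
  moreover have "(real n - 1) / (2 * c) = (real n - 1)\<^sup>2 / (2 * real n)"
    by (simp add: c_def power2_eq_square)
  moreover have "E_double_pos M w0 kp \<gamma>p kd \<gamma>d L =
      ennreal ((real n - 1) / (2 * (kp + \<gamma>p * c) * (kd + \<gamma>d * c)))"
    unfolding E_double_pos_def n(1)
    using a b by (intro expected_P_dav_eq[OF cov] P_dav_double_position L) auto
  moreover have "E_double_vel M w0 kp \<gamma>p kd \<gamma>d L = ennreal ((real n - 1) / (2 * (kd + \<gamma>d * c)))"
    unfolding E_double_vel_def n(1)
    using a b by (intro expected_P_dav_eq[OF cov] P_dav_double_velocity L) auto
  ultimately show "E_single M w0 L = ennreal ((real n - 1)\<^sup>2 / (2 * real n)) \<and>
       E_double_pos M w0 kp \<gamma>p kd \<gamma>d L =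
         ennreal ((real n - 1) /
           (2 * (kp + \<gamma>p * (real n / (real n - 1))) * (kd + \<gamma>d * (real n / (real n - 1))))) \<and>
       E_double_vel M w0 kp \<gamma>p kd \<gamma>d L =
         ennreal ((real n - 1) / (2 * (kd + \<gamma>d * (real n / (real n - 1)))))"
    by (simp add: c_def)
qed

end
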